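(* Let $W=(W_0,\dots,W_T)$ be any sequence of functions $W_t:\mathbb{R}^n\to\mathbb{R}$, let $\mathcal{D}$ be the dual operator of the stochastic dynamic program described in the context, let $\mathcal{D}^kW=\mathcal{D}(\mathcal{D}^{k-1}W)$ for $k\ge 1$ (with $\mathcal{D}^0W=W$), and let $V=(V_0,\dots,V_T)$ be the sequence of true cost-to-go functions. Then: (i) The sequence $\{\mathcal{D}^kW,\ k\ge1\}$ is increasing in $k$, i.e. $(\mathcal{D}^{k+1}W)_t(x)\ge(\mathcal{D}^{k}W)_t(x)$ for all $k\ge1$, $0\le t\le T$ and $x\in\mathbb{R}^n$. (ii) If, for some $k\ge 1$, $(\mathcal{D}^{k+1}W)_t(x)=(\mathcal{D}^{k}W)_t(x)$ for all $0\le t\le T$ and $x\in\mathbb{R}^n$, then $\mathcal{D}^kW\equiv V$, i.e. $(\mathcal{D}^kW)_t(x)=V_t(x)$ for all $t$ and $x$. (iii) $\mathcal{D}^{T+1}W=V$, i.e. $(\mathcal{D}^{T+1}W)_t(x)=V_t(x)$ for all $0\le t\le T$ and $x\in\mathbb{R}^n$.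
   Context: Setting (finite-horizon stochastic dynamic program). Let $T\ge1$ be an integer, $(\Omega,\mathcal{F},\mathbb{P})$ a probability space, $A_t\subseteq\mathbb{R}^m$ ($0\le t\le T-1$) the nonempty sets of feasible actions, and $\xi_0,\dots,\xi_{T-1}$ independent random vectors in $\mathbb{R}^d$. Let $f_t:\mathbb{R}^n\times A_t\times\mathbb{R}^d\to\mathbb{R}^n$ be the transition functions, so that states evolve by $x_{t+1}=f_t(x_t,a_t,\xi_t)$; let $r_t:\mathbb{R}^n\times A_t\times\mathbb{R}^d\to\mathbb{R}$ ($0\le t\le T-1$) be the stage costs and $r_T:\mathbb{R}^n\to\mathbb{R}$ the terminal cost. Cost-to-go functions. Let $\mathcal{F}_t=\sigma(x_0,\dots,x_t)$. For $0\le t\le T-1$, $$V_t(x)=\inf_{\alpha}\mathbb{E}\Big[\sum_{s=t}^{T-1}r_s(x_s,\alpha_s,\xi_s)+r_T(x_T)\,\Big|\,x_t=x\Big],$$ the infimum being over policies $\alpha=(\alpha_t,\dots,\alpha_{T-1})$ with $\alpha_s:\Omega\to A_s$ being $\mathcal{F}_s$-measurable; and $V_T=r_T$. These functions satisfy (and are determined by) the Bellman equations $V_T(x)=r_T(x)$ and $V_t(x)=\inf_{a_t\in A_t}\mathbb{E}[r_t(x,a_t,\xi_t)+V_{t+1}(f_t(x,a_t,\xi_t))]$ for $0\le t\le T-1$, $x\in\mathbb{R}^n$. Dual operator $\mathcal{D}$. Given $W=(W_0,\dots,W_T)$, $W_t:\mathbb{R}^n\to\mathbb{R}$, and $0\le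 t\le T-1$, an action sequence $a=(a_t,\dots,a_{T-1})\in A|t:=A_t\times\cdots\times A_{T-1}$ and a realization $\xi=(\xi_t,\dots,\xi_{T-1})$, generate states from $x_t=x$ by $x_{s+1}=f_s(x_s,a_s,\xi_s)$ and define the penalty $$z_t(a,\xi)=\sum_{s=t}^{T-1}\Big\{\mathbb{E}\big[r_s(x_s,a_s,\xi_s)+W_{s+1}(f_s(x_s,a_s,\xi_s))\big]-\big(r_s(x_s,a_s,\xi_s)+W_{s+1}(f_s(x_s,a_s,\xi_s))\big)\Big\},$$ where the expectation inside the sum is taken only over the distribution of $\xi_s$, with $x_s,a_s$ held fixed. Then $$(\mathcal{D}W)_t(x)=\mathbb{E}\Big[\inf_{a\in A|t}\Big(\sum_{s=t}^{T-1}r_s(x_s,a_s,\xi_s)+r_T(x_T)+z_t(a,\xi)\Big)\Big|\,x_t=x\Big],\quad 0\le t\le T-1,$$ (the infimum is taken separately for each realization of $\xi$), and $(\mathcal{D}W)_T(x)=r_T(x)$. Thus $\mathcal{D}$ maps function sequences to function sequences. Convention: all functions are measurable and all expectations and infima appearing above (for $W$ and its iterates $\mathcal{D}^kW$) are well defined and finite. *)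

theory Defs
  imports "HOL-Probability.Probability"
begin

text \<open>
  States live in \<open>real ^ 'n\<close>, actions in \<open>real ^ 'm\<close>, noise vectors in \<open>real ^ 'd\<close>.  The transition
  and stage cost functions are total in HOL; only their values at actions in \<open>actions P t\<close> and at
  times \<open>t < horizon P\<close> are ever used.
\<close>

record ('w, 'n, 'm, 'd) sdp =
  prob_sp :: "'w measure"
  horizon :: nat
  actions :: "nat \<Rightarrow> (real ^ 'm) set"
  noise :: "nat \<Rightarrow> 'w \<Rightarrow> real ^ 'd"
  transition :: "nat \<Rightarrow> real ^ 'n \<Rightarrow> real ^ 'm \<Rightarrow> real ^ 'd \<Rightarrow> real ^ 'n"
  stage_cost :: "nat \<Rightarrow> real ^ 'n \<Rightarrow> real ^ 'm \<Rightarrow> real ^ 'd \<Rightarrow> real"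
  terminal_cost :: "real ^ 'n \<Rightarrow> real"

definition sdp_setting :: "('w, 'n::finite, 'm::finite, 'd::finite) sdp \<Rightarrow> bool" where
  "sdp_setting P \<longleftrightarrow>
     prob_space (prob_sp P) \<and>
     horizon P \<ge> 1 \<and>
     (\<forall>t<horizon P. actions P t \<noteq> {}) \<and>
     prob_space.indep_vars (prob_sp P) (\<lambda>_. borel) (noise P) {..<horizon P} \<and>
     (\<forall>t<horizon P.
        (\<lambda>(x, a, e). transition P t x a e)
          \<in> borel \<Otimes>\<^sub>M restrict_space borel (actions P t) \<Otimes>\<^sub>M borel \<rightarrow>\<^sub>M borel) \<and>
     (\<forall>t<horizon P.
        (\<lambda>(x, a, e). stage_cost P t x a e)
          \<in> borel \<Otimes>\<^sub>M restrict_space borel (actions P t) \<Otimes>\<^sub>M borel \<rightarrow>\<^sub>M borel) \<and>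
     terminal_cost P \<in> borel \<rightarrow>\<^sub>M borel"

text \<open>
  \<open>state P t x a e s\<close> is the state at time \<open>s \<ge> t\<close> of the system started at time \<open>t\<close> in \<open>x\<close> and
  driven by the actions \<open>a\<close> and the noise realization \<open>e\<close>.  For \<open>s < t\<close> it is the dummy value \<open>x\<close>.
\<close>

primrec state :: "('w, 'n::finite, 'm::finite, 'd::finite) sdp \<Rightarrow> nat \<Rightarrow> real ^ 'n \<Rightarrow>
    (nat \<Rightarrow> real ^ 'm) \<Rightarrow> (nat \<Rightarrow> real ^ 'd) \<Rightarrow> nat \<Rightarrow> real ^ 'n" where
  "state P t x a e 0 = x"
| "state P t x a e (Suc s) =
     (if s < t then x else transition P s (state P t x a e s) (a s) (e s))"

definition total_cost :: "('w, 'n::finite, 'm::finite, 'd::finite) sdp \<Rightarrow> nat \<Rightarrow> real ^ 'n \<Rightarrow>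
    (nat \<Rightarrow> real ^ 'm) \<Rightarrow> (nat \<Rightarrow> real ^ 'd) \<Rightarrow> real" where
  "total_cost P t x a e =
     (\<Sum>s = t..<horizon P. stage_cost P s (state P t x a e s) (a s) (e s)) +
     terminal_cost P (state P t x a e (horizon P))"


subsection \<open>Cost-to-go functions\<close>

text \<open>
  Since the noise is independent over time, the expectation conditional on \<open>x\<^sub>t = x\<close> is the expectation
  for the system started at time \<open>t\<close> in the deterministic state \<open>x\<close>.  The history sigma-algebra is
  the one generated by the states of that system up to time \<open>s\<close> (the dummy states before \<open>t\<close> are
  constant and contribute nothing).
\<close>

definition history :: "('w, 'n::finite, 'm::finite, 'd::finite) sdp \<Rightarrow> nat \<Rightarrow> real ^ 'n \<Rightarrow>
    (nat \<Rightarrow> 'w \<Rightarrow> real ^ 'm) \<Rightarrow> nat \<Rightarrow> 'w measure" where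
  "history P t x \<alpha> s =
     sigma (space (prob_sp P))
       {(\<lambda>\<omega>. state P t x (\<lambda>i. \<alpha> i \<omega>) (\<lambda>i. noise P i \<omega>) u) -` B \<inter> space (prob_sp P)
         | u B. u \<le> s \<and> B \<in> sets borel}"

definition policies :: "('w, 'n::finite, 'm::finite, 'd::finite) sdp \<Rightarrow> nat \<Rightarrow> real ^ 'n \<Rightarrow>
    (nat \<Rightarrow> 'w \<Rightarrow> real ^ 'm) set" where
  "policies P t x =
     {\<alpha>. \<forall>s\<in>{t..<horizon P}. \<alpha> s \<in> history P t x \<alpha> s \<rightarrow>\<^sub>M restrict_space borel (actions P s)}"

definition cost_to_go :: "('w, 'n::finite, 'm::finite, 'd::finite) sdp \<Rightarrow> nat \<Rightarrow> real ^ 'n \<Rightarrow> real"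
  where
  "cost_to_go P t x =
     (if t < horizon P
      then INF \<alpha>\<in>policies P t x.
             (\<integral>\<omega>. total_cost P t x (\<lambda>s. \<alpha> s \<omega>) (\<lambda>s. noise P s \<omega>) \<partial>prob_sp P)
      else terminal_cost P x)"

text \<open>
  The expectations and infima defining the cost-to-go functions, and those on the right-hand side of
  the Bellman equations, are finite.  This must be required explicitly, because in HOL the integral
  of a non-integrable function and the infimum of a set unbounded below have junk values.
\<close>

definition value_wellposed :: "('w, 'n::finite, 'm::finite, 'd::finite) sdp \<Rightarrow> bool" where
  "value_wellposed P \<longleftrightarrow>
     (\<forall>t\<le>horizon P. cost_to_go P t \<in> borel \<rightarrow>\<^sub>M borel) \<and>
     (\<forall>t<horizon P. \<forall>x.
        (\<forall>\<alpha>\<in>policies P t x.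
           integrable (prob_sp P) (\<lambda>\<omega>. total_cost P t x (\<lambda>s. \<alpha> s \<omega>) (\<lambda>s. noise P s \<omega>))) \<and>
        bdd_below ((\<lambda>\<alpha>. \<integral>\<omega>. total_cost P t x (\<lambda>s. \<alpha> s \<omega>) (\<lambda>s. noise P s \<omega>) \<partial>prob_sp P)
                   ` policies P t x) \<and>
        (\<forall>a\<in>actions P t.
           integrable (prob_sp P)
             (\<lambda>\<omega>. stage_cost P t x a (noise P t \<omega>) +
                   cost_to_go P (Suc t) (transition P t x a (noise P t \<omega>)))) \<and>
        bdd_below ((\<lambda>a. \<integral>\<omega>. stage_cost P t x a (noise P t \<omega>) +
                            cost_to_go P (Suc t) (transition P t x a (noise P t \<omega>)) \<partial>prob_sp P)
                   ` actions P t))"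

definition satisfies_bellman :: "('w, 'n::finite, 'm::finite, 'd::finite) sdp \<Rightarrow>
    (nat \<Rightarrow> real ^ 'n \<Rightarrow> real) \<Rightarrow> bool" where
  "satisfies_bellman P V \<longleftrightarrow>
     (\<forall>x. V (horizon P) x = terminal_cost P x) \<and>
     (\<forall>t<horizon P. \<forall>x.
        V t x =
          (INF a\<in>actions P t.
             (\<integral>\<omega>. stage_cost P t x a (noise P t \<omega>) +
                  V (Suc t) (transition P t x a (noise P t \<omega>)) \<partial>prob_sp P)))"


subsection \<open>The dual operator\<close>

definition penalty :: "('w, 'n::finite, 'm::finite, 'd::finite) sdp \<Rightarrow>
    (nat \<Rightarrow> real ^ 'n \<Rightarrow> real) \<Rightarrow> nat \<Rightarrow> real ^ 'n \<Rightarrow>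
    (nat \<Rightarrow> real ^ 'm) \<Rightarrow> (nat \<Rightarrow> real ^ 'd) \<Rightarrow> real" where
  "penalty P W t x a e =
     (\<Sum>s = t..<horizon P.
        (let y = state P t x a e s in
           (\<integral>\<omega>. stage_cost P s y (a s) (noise P s \<omega>) +
                W (Suc s) (transition P s y (a s) (noise P s \<omega>)) \<partial>prob_sp P) -
           (stage_cost P s y (a s) (e s) + W (Suc s) (transition P s y (a s) (e s)))))"

text \<open>The infimum over all action sequences, for a fixed noise realization \<open>e\<close>.\<close>

definition pathwise_inf :: "('w, 'n::finite, 'm::finite, 'd::finite) sdp \<Rightarrow>
    (nat \<Rightarrow> real ^ 'n \<Rightarrow> real) \<Rightarrow> nat \<Rightarrow> real ^ 'n \<Rightarrow> (nat \<Rightarrow> real ^ 'd) \<Rightarrow> real" where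
  "pathwise_inf P W t x e =
     (INF a\<in>(\<Pi>\<^sub>E s\<in>{t..<horizon P}. actions P s). total_cost P t x a e + penalty P W t x a e)"

definition dual_op :: "('w, 'n::finite, 'm::finite, 'd::finite) sdp \<Rightarrow>
    (nat \<Rightarrow> real ^ 'n \<Rightarrow> real) \<Rightarrow> nat \<Rightarrow> real ^ 'n \<Rightarrow> real" where
  "dual_op P W t x =
     (if t < horizon P
      then (\<integral>\<omega>. pathwise_inf P W t x (\<lambda>s. noise P s \<omega>) \<partial>prob_sp P)
      else terminal_cost P x)"

text \<open>
  Measurability of \<open>W\<close> and of everything that is integrated when \<open>dual_op P\<close> is applied to \<open>W\<close>, and
  finiteness of all expectations and infima involved.  The pathwise infimum is required to be
  measurable as a function of the realization \<open>(\<xi>\<^sub>t, \<dots>, \<xi>\<^bsub>T-1\<^esub>)\<close>, and finite for almost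
  every realization with respect to the joint law of the noise.
\<close>

definition dual_wellposed :: "('w, 'n::finite, 'm::finite, 'd::finite) sdp \<Rightarrow>
    (nat \<Rightarrow> real ^ 'n \<Rightarrow> real) \<Rightarrow> bool" where
  "dual_wellposed P W \<longleftrightarrow>
     (\<forall>t\<le>horizon P. W t \<in> borel \<rightarrow>\<^sub>M borel) \<and>
     (\<forall>t<horizon P. \<forall>x.
        (\<forall>a\<in>actions P t.
           integrable (prob_sp P)
             (\<lambda>\<omega>. stage_cost P t x a (noise P t \<omega>) +
                   W (Suc t) (transition P t x a (noise P t \<omega>)))) \<and>
        pathwise_inf P W t x \<in> (\<Pi>\<^sub>M s\<in>{t..<horizon P}. borel) \<rightarrow>\<^sub>M borel \<and>
        (AE e in distr (prob_sp P) (\<Pi>\<^sub>M s\<in>{t..<horizon P}. borel)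
                   (\<lambda>\<omega>. \<lambda>s\<in>{t..<horizon P}. noise P s \<omega>).
           bdd_below ((\<lambda>a. total_cost P t x a e + penalty P W t x a e)
                      ` (\<Pi>\<^sub>E s\<in>{t..<horizon P}. actions P s))) \<and>
        integrable (prob_sp P) (\<lambda>\<omega>. pathwise_inf P W t x (\<lambda>s. noise P s \<omega>)))"

end

theory Submission
  imports Defs
begin

text \<open>
  Call \<open>U\<close> a subsolution if it satisfies the Bellman equations with \<open>\<le>\<close> in place of equality.  The
  stage costs in the objective of the dual problem cancel against those in the penalty, and what
  remains is
  \[ r_T(x_T) + \sum_{s=t}^{T-1} \bigl( Q_s(x_s, a_s) - U_{s+1}(x_{s+1}) \bigr), \qquad
     Q_s(y, b) = E[ r_s(y, b, \xi_s) + U_{s+1}(f_s(y, b, \xi_s)) ]. \]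
  Everything rests on two observations about this sum.

  For a subsolution, \<open>Q\<^sub>s(x\<^sub>s, a\<^sub>s) \<ge> U\<^sub>s(x\<^sub>s)\<close>, so the sum telescopes to at least \<open>U\<^sub>t(x)\<close> along every
  path and for every choice of actions (lemma \<open>subsolution_le_pathwise_inf\<close>).  Hence the dual operator
  \<open>D\<close> increases subsolutions.

  For arbitrary \<open>U\<close>, the image \<open>D U\<close> is a subsolution (lemma \<open>dual_op_subsolution\<close>).  Fixing the first
  action can only increase the infimum, and averaging over the later noise turns the remaining
  infimum into \<open>(D U)\<^sub>t\<^sub>+\<^sub>1\<close>; averaging over the current noise then cancels the expectation of
  \<open>U\<^sub>t\<^sub>+\<^sub>1\<close> in \<open>Q\<^sub>t\<close> against the subtracted \<open>U\<^sub>t\<^sub>+\<^sub>1\<close>, leaving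
  \<open>E[r\<^sub>t + (D U)\<^sub>t\<^sub>+\<^sub>1]\<close>.

  Together these make the iterates increase from the first one on.  A subsolution lies below the
  cost-to-go functions \<open>V\<close> by backward induction, so every \<open>D U\<close> does.  Conversely \<open>V\<close> is itself a
  subsolution, and \<open>(D U)\<^sub>t\<close> depends only on \<open>U\<^sub>s\<close> with \<open>s > t\<close>; so if \<open>U\<close> agrees with \<open>V\<close> after time
  \<open>t\<close>, then \<open>(D U)\<^sub>t \<ge> V\<^sub>t\<close>, hence \<open>(D U)\<^sub>t = V\<^sub>t\<close> (lemma \<open>dual_op_eq_cost_to_go\<close>).  Each application
  of \<open>D\<close> therefore makes one more time step exact, starting from the terminal one, and a fixed point
  of \<open>D\<close> is exact at all times.
\<close>

section \<open>State trajectories\<close>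

lemma state_start [simp]: "state P t x a e t = x"
  by (cases t) auto

lemma state_cong:
  assumes "\<And>i. i \<in> {t..<s} \<Longrightarrow> a i = a' i" "\<And>i. i \<in> {t..<s} \<Longrightarrow> e i = e' i"
  shows "state P t x a e s = state P t x a' e' s"
  using assms by (induction s) auto

lemma state_restart:
  assumes "Suc t \<le> s"
  shows "state P t x a e s = state P (Suc t) (transition P t x (a t) (e t)) a e s"
  using assms
proof (induction s rule: dec_induct)
  case base
  show ?case by simp
next
  case (step s)
  then show ?case by simp
qed

section \<open>The objective of the pathwise problem\<close>

definition q_value :: "('w, 'n::finite, 'm::finite, 'd::finite) sdp \<Rightarrow>
    (nat \<Rightarrow> real ^ 'n \<Rightarrow> real) \<Rightarrow> nat \<Rightarrow> real ^ 'n \<Rightarrow> real ^ 'm \<Rightarrow> real" where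
  "q_value P U t x a =
     (\<integral>\<omega>. stage_cost P t x a (noise P t \<omega>) +
          U (Suc t) (transition P t x a (noise P t \<omega>)) \<partial>prob_sp P)"

definition penalized_cost :: "('w, 'n::finite, 'm::finite, 'd::finite) sdp \<Rightarrow>
    (nat \<Rightarrow> real ^ 'n \<Rightarrow> real) \<Rightarrow> nat \<Rightarrow> real ^ 'n \<Rightarrow>
    (nat \<Rightarrow> real ^ 'm) \<Rightarrow> (nat \<Rightarrow> real ^ 'd) \<Rightarrow> real" where
  "penalized_cost P U t x a e = total_cost P t x a e + penalty P U t x a e"

lemma pathwise_inf_alt:
  "pathwise_inf P U t x e =
     (INF a\<in>(\<Pi>\<^sub>E s\<in>{t..<horizon P}. actions P s). penalized_cost P U t x a e)"
  by (simp add: pathwise_inf_def penalized_cost_def)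

text \<open>The stage costs along the path cancel against those subtracted in the penalty.\<close>

lemma penalized_cost_eq:
  "penalized_cost P U t x a e =
     (\<Sum>s = t..<horizon P. q_value P U s (state P t x a e s) (a s)
                          - U (Suc s) (state P t x a e (Suc s)))
     + terminal_cost P (state P t x a e (horizon P))"
  unfolding penalized_cost_def total_cost_def penalty_def q_value_def Let_def
  by (simp add: sum.distrib[symmetric] sum_subtractf[symmetric] algebra_simps
      cong: sum.cong_simp)

lemma penalized_cost_horizon [simp]:
  "penalized_cost P U (horizon P) x a e = terminal_cost P x"
  by (simp add: penalized_cost_eq)

lemma penalized_cost_step:
  assumes "t < horizon P" and "y = transition P t x (a t) (e t)"
  shows "penalized_cost P U t x a e =
     q_value P U t x (a t) - U (Suc t) y + penalized_cost P U (Suc t) y a e"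
proof -
  have st: "state P t x a e s = state P (Suc t) y a e s" if "Suc t \<le> s" for s
    using state_restart[OF that] assms(2) by simp
  have "penalized_cost P U t x a e = q_value P U t x (a t) - U (Suc t) y
     + (\<Sum>s = Suc t..<horizon P. q_value P U s (state P t x a e s) (a s)
                          - U (Suc s) (state P t x a e (Suc s)))
     + terminal_cost P (state P t x a e (horizon P))"
    using assms by (simp add: penalized_cost_eq sum.atLeast_Suc_lessThan)
  also have "(\<Sum>s = Suc t..<horizon P. q_value P U s (state P t x a e s) (a s)
                          - U (Suc s) (state P t x a e (Suc s))) =
      (\<Sum>s = Suc t..<horizon P. q_value P U s (state P (Suc t) y a e s) (a s)
                          - U (Suc s) (state P (Suc t) y a e (Suc s)))"
    by (intro sum.cong refl arg_cong2[where f = "(-)"]) (auto simp only: st atLeastLessThan_iff le_SucI)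
  also have "state P t x a e (horizon P) = state P (Suc t) y a e (horizon P)"
    using assms by (intro st) simp
  finally show ?thesis
    by (simp add: penalized_cost_eq del: state.simps)
qed

lemma penalized_cost_cong:
  assumes "t \<le> horizon P"
    and "\<And>s. s \<in> {t..<horizon P} \<Longrightarrow> a s = a' s"
    and "\<And>s. s \<in> {t..<horizon P} \<Longrightarrow> e s = e' s"
    and "\<And>s x. s \<in> {Suc t..horizon P} \<Longrightarrow> U s x = U' s x"
  shows "penalized_cost P U t x a e = penalized_cost P U' t x a' e'"
proof -
  have st: "state P t x a e s = state P t x a' e' s" if "s \<le> horizon P" for s
    using that assms by (intro state_cong) auto
  have q: "q_value P U s z b = q_value P U' s z b" if "s \<in> {t..<horizon P}" for s z b
    unfolding q_value_def using that assms(4) by (intro Bochner_Integration.integral_cong) auto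
  show ?thesis
    unfolding penalized_cost_eq using assms
    by (intro arg_cong2[where f = "(+)"] sum.cong) (auto simp: st q simp del: state.simps)
qed

lemma pathwise_inf_cong:
  assumes "t \<le> horizon P"
    and "\<And>s. s \<in> {t..<horizon P} \<Longrightarrow> e s = e' s"
    and "\<And>s x. s \<in> {Suc t..horizon P} \<Longrightarrow> U s x = U' s x"
  shows "pathwise_inf P U t x e = pathwise_inf P U' t x e'"
  unfolding pathwise_inf_alt using assms
  by (intro INF_cong refl penalized_cost_cong) auto

lemma action_sequences_nonempty:
  assumes "sdp_setting P"
  shows "(\<Pi>\<^sub>E s\<in>{t..<horizon P}. actions P s) \<noteq> {}"
  using assms by (auto simp: sdp_setting_def PiE_eq_empty_iff)

lemma pathwise_inf_horizon [simp]: "pathwise_inf P U (horizon P) x e = terminal_cost P x"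
  by (simp add: pathwise_inf_alt)

text \<open>
  One half of dynamic programming along a fixed noise path: committing to a first action can only
  increase the infimum over action sequences.
\<close>

lemma pathwise_inf_le_step:
  assumes setting: "sdp_setting P" and t: "t < horizon P" and a: "a \<in> actions P t"
    and bdd: "bdd_below ((\<lambda>a. penalized_cost P U t x a e)
                 ` (\<Pi>\<^sub>E s\<in>{t..<horizon P}. actions P s))"
    and y: "y = transition P t x a (e t)"
  shows "pathwise_inf P U t x e \<le>
     q_value P U t x a - U (Suc t) y + pathwise_inf P U (Suc t) y e"
proof -
  have "pathwise_inf P U t x e - (q_value P U t x a - U (Suc t) y) \<le>
          pathwise_inf P U (Suc t) y e"
    unfolding pathwise_inf_alt[of P U "Suc t"]
  proof (rule cINF_greatest)
    show "(\<Pi>\<^sub>E s\<in>{Suc t..<horizon P}. actions P s) \<noteq> {}"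
      using setting by (rule action_sequences_nonempty)
    fix b assume b: "b \<in> (\<Pi>\<^sub>E s\<in>{Suc t..<horizon P}. actions P s)"
    have "insert t {Suc t..<horizon P} = {t..<horizon P}"
      using t by auto
    then have "b(t := a) \<in> (\<Pi>\<^sub>E s\<in>{t..<horizon P}. actions P s)"
      using PiE_fun_upd[OF a b] by simp
    then have "pathwise_inf P U t x e \<le> penalized_cost P U t x (b(t := a)) e"
      unfolding pathwise_inf_alt by (intro cINF_lower[OF bdd])
    also have "\<dots> = q_value P U t x a - U (Suc t) y
                    + penalized_cost P U (Suc t) y (b(t := a)) e"
      using t by (simp add: penalized_cost_step y)
    also have "penalized_cost P U (Suc t) y (b(t := a)) e = penalized_cost P U (Suc t) y b e"
      using t by (intro penalized_cost_cong) auto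
    finally show "pathwise_inf P U t x e - (q_value P U t x a - U (Suc t) y) \<le>
        penalized_cost P U (Suc t) y b e"
      by simp
  qed
  then show ?thesis by simp
qed

section \<open>Subsolutions of the Bellman equations\<close>

definition bellman_subsolution :: "('w, 'n::finite, 'm::finite, 'd::finite) sdp \<Rightarrow>
    (nat \<Rightarrow> real ^ 'n \<Rightarrow> real) \<Rightarrow> bool" where
  "bellman_subsolution P U \<longleftrightarrow>
     (\<forall>x. U (horizon P) x \<le> terminal_cost P x) \<and>
     (\<forall>t<horizon P. \<forall>x. \<forall>a\<in>actions P t. U t x \<le> q_value P U t x a)"

text \<open>
  A subsolution bounds each term of the objective below by the increment
  \<open>U\<^sub>s(x\<^sub>s) - U\<^sub>s\<^sub>+\<^sub>1(x\<^sub>s\<^sub>+\<^sub>1)\<close>, and these increments telescope.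
\<close>

lemma subsolution_le_pathwise_inf:
  assumes "sdp_setting P" and sub: "bellman_subsolution P U" and t: "t \<le> horizon P"
  shows "U t x \<le> pathwise_inf P U t x e"
  unfolding pathwise_inf_alt
proof (rule cINF_greatest[OF action_sequences_nonempty[OF assms(1)]])
  fix a assume "a \<in> (\<Pi>\<^sub>E s\<in>{t..<horizon P}. actions P s)"
  then have a: "a s \<in> actions P s" if "s \<in> {t..<horizon P}" for s
    using that by auto
  let ?x = "state P t x a e"
  have "U t x = (\<Sum>s = t..<horizon P. U s (?x s) - U (Suc s) (?x (Suc s)))
                 + U (horizon P) (?x (horizon P))"
    using sum_Suc_diff'[OF t, of "\<lambda>s. - U s (?x s)"] by simp
  also have "\<dots> \<le> penalized_cost P U t x a e"
    unfolding penalized_cost_eq using sub a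
    by (intro add_mono sum_mono diff_right_mono) (auto simp: bellman_subsolution_def)
  finally show "U t x \<le> penalized_cost P U t x a e" .
qed

lemma integrable_pathwise_inf:
  assumes "sdp_setting P" "dual_wellposed P U" "t \<le> horizon P"
  shows "integrable (prob_sp P) (\<lambda>\<omega>. pathwise_inf P U t x (\<lambda>s. noise P s \<omega>))"
proof (cases "t = horizon P")
  case True
  interpret prob_space "prob_sp P"
    using assms(1) by (simp add: sdp_setting_def)
  from True show ?thesis by simp
next
  case False
  then show ?thesis using assms by (simp add: dual_wellposed_def)
qed

lemma dual_op_alt:
  assumes "sdp_setting P" "t \<le> horizon P"
  shows "dual_op P U t x = (\<integral>\<omega>. pathwise_inf P U t x (\<lambda>s. noise P s \<omega>) \<partial>prob_sp P)"
proof (cases "t = horizon P")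
  case True
  interpret prob_space "prob_sp P"
    using assms(1) by (simp add: sdp_setting_def)
  from True show ?thesis by (simp add: dual_op_def prob_space)
next
  case False
  then show ?thesis using assms by (simp add: dual_op_def)
qed

text \<open>
  The operator at time \<open>t\<close> sees its argument only after time \<open>t\<close>.  With \<open>U = L\<close> this gives the
  monotonicity of the iterates; with \<open>L\<close> the cost-to-go functions it turns exactness of \<open>U\<close> after
  time \<open>t\<close> into a lower bound at time \<open>t\<close>.
\<close>

lemma subsolution_le_dual_op:
  assumes setting: "sdp_setting P" and sub: "bellman_subsolution P L" and t: "t \<le> horizon P"
    and wp: "dual_wellposed P U"
    and eq: "\<And>s x. s \<in> {Suc t..horizon P} \<Longrightarrow> U s x = L s x"
  shows "L t x \<le> dual_op P U t x"
proof -
  interpret prob_space "prob_sp P"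
    using setting by (simp add: sdp_setting_def)
  have "pathwise_inf P U t x e = pathwise_inf P L t x e" for e
    using t eq by (intro pathwise_inf_cong) auto
  then have "L t x \<le> pathwise_inf P U t x e" for e
    using subsolution_le_pathwise_inf[OF setting sub t] by simp
  then show ?thesis
    unfolding dual_op_alt[OF setting t]
    by (intro integral_ge_const integrable_pathwise_inf[OF setting wp t]) auto
qed

section \<open>Images under the dual operator are subsolutions\<close>

text \<open>
  The noise at time \<open>t\<close> is independent of the noise after \<open>t\<close>, so an expectation over both is an
  iterated one; the map in the second statement recovers a realization from time \<open>t\<close> on from
  its two parts.
\<close>

lemma noise_split:
  fixes P :: "('w, 'n::finite, 'm::finite, 'd::finite) sdp"
  assumes setting: "sdp_setting P" and t: "t < horizon P"
  defines "N1 \<equiv> distr (prob_sp P) borel (noise P t)"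
    and "N2 \<equiv> distr (prob_sp P) (\<Pi>\<^sub>M s\<in>{Suc t..<horizon P}. borel)
                (\<lambda>\<omega>. \<lambda>s\<in>{Suc t..<horizon P}. noise P s \<omega>)"
  shows "distr (prob_sp P) (borel \<Otimes>\<^sub>M (\<Pi>\<^sub>M s\<in>{Suc t..<horizon P}. borel))
             (\<lambda>\<omega>. (noise P t \<omega>, \<lambda>s\<in>{Suc t..<horizon P}. noise P s \<omega>)) = N1 \<Otimes>\<^sub>M N2"
    and "(\<lambda>(u, v). v(t := u)) \<in> N1 \<Otimes>\<^sub>M N2 \<rightarrow>\<^sub>M (\<Pi>\<^sub>M s\<in>{t..<horizon P}. (borel :: (real ^ 'd) measure))"
proof -
  let ?J = "{Suc t..<horizon P}"
  interpret prob_space "prob_sp P"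
    using setting by (simp add: sdp_setting_def)
  have indep: "indep_vars (\<lambda>_. borel) (noise P) {..<horizon P}"
    using setting by (simp add: sdp_setting_def)
  have "indep_var (\<Pi>\<^sub>M s\<in>{t}. borel) (\<lambda>\<omega>. \<lambda>s\<in>{t}. noise P s \<omega>)
          (\<Pi>\<^sub>M s\<in>?J. borel) (\<lambda>\<omega>. \<lambda>s\<in>?J. noise P s \<omega>)"
    using t by (intro indep_var_restrict[OF indep]) auto
  then have joint: "distr (prob_sp P) (\<Pi>\<^sub>M s\<in>{t}. borel) (\<lambda>\<omega>. \<lambda>s\<in>{t}. noise P s \<omega>) \<Otimes>\<^sub>M N2 =
      distr (prob_sp P) ((\<Pi>\<^sub>M s\<in>{t}. borel) \<Otimes>\<^sub>M (\<Pi>\<^sub>M s\<in>?J. borel))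
        (\<lambda>\<omega>. (\<lambda>s\<in>{t}. noise P s \<omega>, \<lambda>s\<in>?J. noise P s \<omega>))"
    and [measurable]: "(\<lambda>\<omega>. \<lambda>s\<in>{t}. noise P s \<omega>) \<in> prob_sp P \<rightarrow>\<^sub>M (\<Pi>\<^sub>M s\<in>{t}. borel)"
      "(\<lambda>\<omega>. \<lambda>s\<in>?J. noise P s \<omega>) \<in> prob_sp P \<rightarrow>\<^sub>M (\<Pi>\<^sub>M s\<in>?J. borel)"
    unfolding N2_def by (auto simp: indep_var_distribution_eq)
  \<comment> \<open>The noise at time \<open>t\<close> enters as a family indexed by \<open>{t}\<close>, so that both independent
    variables are families of vectors; evaluation at \<open>t\<close> then returns the vector itself.\<close>
  have N1: "N1 = distr (distr (prob_sp P) (\<Pi>\<^sub>M s\<in>{t}. borel) (\<lambda>\<omega>. \<lambda>s\<in>{t}. noise P s \<omega>)) borel (\<lambda>h. h t)"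
    unfolding N1_def by (subst distr_distr) (auto simp: comp_def)
  have N2: "N2 = distr N2 (\<Pi>\<^sub>M s\<in>?J. borel) (\<lambda>v. v)"
    by (simp add: N2_def distr_id2)
  interpret N2: prob_space N2
    unfolding N2_def by (rule prob_space_distr) measurable
  have "N1 \<Otimes>\<^sub>M N2 =
      distr (distr (prob_sp P) (\<Pi>\<^sub>M s\<in>{t}. borel) (\<lambda>\<omega>. \<lambda>s\<in>{t}. noise P s \<omega>) \<Otimes>\<^sub>M N2)
        (borel \<Otimes>\<^sub>M (\<Pi>\<^sub>M s\<in>?J. borel)) (\<lambda>(h, v). (h t, v))"
    unfolding N1 by (subst N2, rule pair_measure_distr)
      (auto simp: N2[symmetric] N2.sigma_finite_measure_axioms, auto simp: N2_def)
  also have "\<dots> = distr (prob_sp P) (borel \<Otimes>\<^sub>M (\<Pi>\<^sub>M s\<in>?J. borel))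
      (\<lambda>\<omega>. (noise P t \<omega>, \<lambda>s\<in>?J. noise P s \<omega>))"
    unfolding joint by (subst distr_distr) (auto simp: comp_def)
  finally show "distr (prob_sp P) (borel \<Otimes>\<^sub>M (\<Pi>\<^sub>M s\<in>?J. borel))
             (\<lambda>\<omega>. (noise P t \<omega>, \<lambda>s\<in>?J. noise P s \<omega>)) = N1 \<Otimes>\<^sub>M N2" ..
  have ins: "insert t ?J = {t..<horizon P}" using t by auto
  have "(\<lambda>p. (snd p)(t := fst p)) \<in> N1 \<Otimes>\<^sub>M N2 \<rightarrow>\<^sub>M (\<Pi>\<^sub>M s\<in>{t..<horizon P}. (borel :: (real ^ 'd) measure))"
    unfolding ins[symmetric] N1_def N2_def
    by (rule measurable_fun_upd[where J = ?J]) auto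
  then show "(\<lambda>(u, v). v(t := u)) \<in> N1 \<Otimes>\<^sub>M N2 \<rightarrow>\<^sub>M (\<Pi>\<^sub>M s\<in>{t..<horizon P}. (borel :: (real ^ 'd) measure))"
    by (simp add: case_prod_beta')
qed

lemma one_step_measurable:
  fixes P :: "('w, 'n::finite, 'm::finite, 'd::finite) sdp"
  assumes setting: "sdp_setting P" and t: "t < horizon P" and a: "a \<in> actions P t"
    and wp: "dual_wellposed P U"
  shows "(\<lambda>u. stage_cost P t x a u + U (Suc t) (transition P t x a u)) \<in> borel_measurable borel"
proof -
  have pair: "(\<lambda>u. (x, a, u)) \<in>
      borel \<rightarrow>\<^sub>M borel \<Otimes>\<^sub>M restrict_space borel (actions P t) \<Otimes>\<^sub>M borel"
    using a by (intro measurable_Pair measurable_const) (auto simp: space_restrict_space)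
  have "(\<lambda>(x, a, e). transition P t x a e)
      \<in> borel \<Otimes>\<^sub>M restrict_space borel (actions P t) \<Otimes>\<^sub>M borel \<rightarrow>\<^sub>M borel"
    using setting t unfolding sdp_setting_def by blast
  from measurable_compose[OF pair this]
  have [measurable]: "(\<lambda>u. transition P t x a u) \<in> borel_measurable borel"
    by simp
  have "(\<lambda>(x, a, e). stage_cost P t x a e)
      \<in> borel \<Otimes>\<^sub>M restrict_space borel (actions P t) \<Otimes>\<^sub>M borel \<rightarrow>\<^sub>M borel"
    using setting t unfolding sdp_setting_def by blast
  from measurable_compose[OF pair this]
  have [measurable]: "(\<lambda>u. stage_cost P t x a u) \<in> borel_measurable borel"
    by simp
  have [measurable]: "U (Suc t) \<in> borel_measurable borel"
    using wp t by (simp add: dual_wellposed_def)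
  show ?thesis by measurable
qed

text \<open>
  The pathwise infimum is only known to be measurable in the noise for each fixed state, so the
  bound by the infimum of the restarted problem cannot be integrated over all the noise at once.
  It is integrated over the later noise first, when the noise at time \<open>t\<close>, and with it the next
  state, is held fixed; after that only the functions \<open>U\<close> and \<open>D U\<close> themselves appear.
\<close>

lemma dual_op_subsolution:
  fixes P :: "('w, 'n::finite, 'm::finite, 'd::finite) sdp"
  assumes setting: "sdp_setting P" and wp: "dual_wellposed P U"
    and wp': "dual_wellposed P (dual_op P U)"
  shows "bellman_subsolution P (dual_op P U)"
  unfolding bellman_subsolution_def
proof (intro conjI allI impI ballI)
  fix x show "dual_op P U (horizon P) x \<le> terminal_cost P x"
    by (simp add: dual_op_def)
next
  fix t x a assume t: "t < horizon P" and a: "a \<in> actions P t"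
  let ?J = "{Suc t..<horizon P}" and ?I = "{t..<horizon P}"
  let ?f = "transition P t x a"
  let ?N1 = "distr (prob_sp P) borel (noise P t)"
  let ?rest = "\<lambda>\<omega>. \<lambda>s\<in>?J. noise P s \<omega>"
  let ?N2 = "distr (prob_sp P) (\<Pi>\<^sub>M s\<in>?J. borel) ?rest"
  define G where "G u v = pathwise_inf P U t x (v(t := u))" for u v
  let ?q = "q_value P U t x a"
  interpret prob_space "prob_sp P"
    using setting by (simp add: sdp_setting_def)
  have noise [measurable]: "noise P s \<in> prob_sp P \<rightarrow>\<^sub>M borel" if "s < horizon P" for s
    using setting that by (auto simp: sdp_setting_def indep_vars_def)
  note [measurable] = noise[OF t]
  have rest [measurable]: "?rest \<in> prob_sp P \<rightarrow>\<^sub>M (\<Pi>\<^sub>M s\<in>?J. borel)"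
    by (intro measurable_restrict noise) auto
  interpret N1: prob_space ?N1 by (rule prob_space_distr) simp
  interpret N2: prob_space ?N2 by (rule prob_space_distr) simp
  interpret pair_sigma_finite ?N1 ?N2 ..
  note split = noise_split(1)[OF setting t] and [measurable] = noise_split(2)[OF setting t]
  have G_meas [measurable]: "(\<lambda>(u, v). G u v) \<in> borel_measurable (?N1 \<Otimes>\<^sub>M ?N2)"
  proof -
    have "pathwise_inf P U t x \<in> borel_measurable (\<Pi>\<^sub>M s\<in>?I. borel)"
      using wp t by (simp add: dual_wellposed_def)
    from measurable_compose[OF noise_split(2)[OF setting t] this] show ?thesis
      by (simp add: case_prod_beta' G_def)
  qed
  have pair [measurable]: "(\<lambda>\<omega>. (noise P t \<omega>, ?rest \<omega>)) \<in>
      prob_sp P \<rightarrow>\<^sub>M borel \<Otimes>\<^sub>M (\<Pi>\<^sub>M s\<in>?J. borel)"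
    by measurable
  have G_meas' [measurable]:
    "(\<lambda>(u, v). G u v) \<in> borel_measurable (borel \<Otimes>\<^sub>M (\<Pi>\<^sub>M s\<in>?J. borel))"
    using G_meas by (simp cong: measurable_cong_sets)
  have G_noise: "G (noise P t \<omega>) (?rest \<omega>) = pathwise_inf P U t x (\<lambda>s. noise P s \<omega>)" for \<omega>
    unfolding G_def using t by (intro pathwise_inf_cong) auto
  have G_int: "integrable (?N1 \<Otimes>\<^sub>M ?N2) (\<lambda>(u, v). G u v)"
    unfolding split[symmetric] using integrable_pathwise_inf[OF setting wp, of t x] t
    by (subst integrable_distr_eq) (auto simp: G_noise)
  have G_eq: "dual_op P U t x = (\<integral>u. (\<integral>v. G u v \<partial>?N2) \<partial>?N1)"
  proof -
    have "dual_op P U t x = (\<integral>p. (case p of (u, v) \<Rightarrow> G u v) \<partial>(?N1 \<Otimes>\<^sub>M ?N2))"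
      unfolding split[symmetric] using t
      by (subst integral_distr) (auto simp: G_noise dual_op_alt[OF setting])
    also have "\<dots> = (\<integral>u. (\<integral>v. G u v \<partial>?N2) \<partial>?N1)"
      using integral_fst'[OF G_int] by simp
    finally show ?thesis .
  qed
  have bdd: "AE u in ?N1. AE v in ?N2.
      bdd_below ((\<lambda>b. penalized_cost P U t x b (v(t := u))) ` (\<Pi>\<^sub>E s\<in>?I. actions P s))"
  proof -
    have "(\<lambda>\<omega>. \<lambda>s\<in>?I. noise P s \<omega>) = (\<lambda>(u, v). v(t := u)) \<circ> (\<lambda>\<omega>. (noise P t \<omega>, ?rest \<omega>))"
      using t by (auto simp: fun_eq_iff)
    then have "distr (prob_sp P) (\<Pi>\<^sub>M s\<in>?I. borel) (\<lambda>\<omega>. \<lambda>s\<in>?I. noise P s \<omega>) =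
        distr (?N1 \<Otimes>\<^sub>M ?N2) (\<Pi>\<^sub>M s\<in>?I. borel) (\<lambda>(u, v). v(t := u))"
      using noise_split(2)[OF setting t]
      unfolding split[symmetric] by (subst distr_distr) auto
    moreover have "AE e in distr (prob_sp P) (\<Pi>\<^sub>M s\<in>?I. borel) (\<lambda>\<omega>. \<lambda>s\<in>?I. noise P s \<omega>).
        bdd_below ((\<lambda>b. penalized_cost P U t x b e) ` (\<Pi>\<^sub>E s\<in>?I. actions P s))"
      using wp t by (simp add: dual_wellposed_def penalized_cost_def)
    ultimately have "AE e in distr (?N1 \<Otimes>\<^sub>M ?N2) (\<Pi>\<^sub>M s\<in>?I. borel) (\<lambda>(u, v). v(t := u)).
        bdd_below ((\<lambda>b. penalized_cost P U t x b e) ` (\<Pi>\<^sub>E s\<in>?I. actions P s))"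
      by (simp only:)
    from AE_distrD[OF noise_split(2)[OF setting t] this]
    have "AE p in ?N1 \<Otimes>\<^sub>M ?N2. bdd_below
        ((\<lambda>b. penalized_cost P U t x b ((\<lambda>(u, v). v(t := u)) p)) ` (\<Pi>\<^sub>E s\<in>?I. actions P s))" .
    from AE_pair[OF this] show ?thesis by simp
  qed
  have G_le: "G u v \<le> ?q - U (Suc t) (?f u) + pathwise_inf P U (Suc t) (?f u) v"
    if "bdd_below ((\<lambda>b. penalized_cost P U t x b (v(t := u))) ` (\<Pi>\<^sub>E s\<in>?I. actions P s))"
    for u v
  proof -
    have "pathwise_inf P U (Suc t) (?f u) (v(t := u)) = pathwise_inf P U (Suc t) (?f u) v"
      using t by (intro pathwise_inf_cong) auto
    then show ?thesis
      using pathwise_inf_le_step[OF setting t a that refl] by (simp add: G_def)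
  qed
  have tail: "integrable ?N2 (pathwise_inf P U (Suc t) y) \<and>
      (\<integral>v. pathwise_inf P U (Suc t) y v \<partial>?N2) = dual_op P U (Suc t) y" for y
  proof -
    have [measurable]: "pathwise_inf P U (Suc t) y \<in> borel_measurable (\<Pi>\<^sub>M s\<in>?J. borel)"
    proof (cases "Suc t = horizon P")
      case True
      then have "pathwise_inf P U (Suc t) y = (\<lambda>_. terminal_cost P y)"
        by (simp only: fun_eq_iff pathwise_inf_horizon) simp
      then show ?thesis by simp
    next
      case False
      then show ?thesis using wp t by (simp add: dual_wellposed_def)
    qed
    have "pathwise_inf P U (Suc t) y (?rest \<omega>) = pathwise_inf P U (Suc t) y (\<lambda>s. noise P s \<omega>)" for \<omega>
      using t by (intro pathwise_inf_cong) auto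
    then show ?thesis
      using integrable_pathwise_inf[OF setting wp, of "Suc t" y] t dual_op_alt[OF setting, of "Suc t" U y]
      by (simp add: integrable_distr_eq integral_distr)
  qed
  have inner: "AE u in ?N1.
      (\<integral>v. G u v \<partial>?N2) \<le> ?q - U (Suc t) (?f u) + dual_op P U (Suc t) (?f u)"
    using bdd AE_integrable_fst'[OF G_int]
  proof eventually_elim
    case (elim u)
    have "(\<integral>v. G u v \<partial>?N2) \<le>
        (\<integral>v. ?q - U (Suc t) (?f u) + pathwise_inf P U (Suc t) (?f u) v \<partial>?N2)"
    proof (rule integral_mono_AE)
      show "integrable ?N2 (\<lambda>v. G u v)" using elim(2) by simp
      show "integrable ?N2 (\<lambda>v. ?q - U (Suc t) (?f u) + pathwise_inf P U (Suc t) (?f u) v)"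
        using tail by (intro Bochner_Integration.integrable_add N2.integrable_const) auto
      show "AE v in ?N2. G u v \<le> ?q - U (Suc t) (?f u) + pathwise_inf P U (Suc t) (?f u) v"
        using elim(1) by eventually_elim (rule G_le)
    qed
    also have "\<dots> = ?q - U (Suc t) (?f u) + dual_op P U (Suc t) (?f u)"
      using tail[of "?f u"] N2.prob_space
      by (subst Bochner_Integration.integral_add) auto
    finally show ?case .
  qed
  \<comment> \<open>The stage cost is added and subtracted, because integrability is known for the one-step
    costs of \<open>U\<close> and of \<open>D U\<close>, but not for these functions at the next state by themselves.\<close>
  let ?h = "\<lambda>U u. stage_cost P t x a u + U (Suc t) (?f u)"
  have h: "integrable ?N1 (?h L)" "(\<integral>u. ?h L u \<partial>?N1) = q_value P L t x a"
    if "dual_wellposed P L" for L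
  proof -
    note m = one_step_measurable[OF setting t a that, of x]
    show "integrable ?N1 (?h L)"
      using that t a m by (subst integrable_distr_eq) (auto simp: dual_wellposed_def)
    show "(\<integral>u. ?h L u \<partial>?N1) = q_value P L t x a"
      using m by (subst integral_distr) (auto simp: q_value_def)
  qed
  have "dual_op P U t x \<le> (\<integral>u. ?q - ?h U u + ?h (dual_op P U) u \<partial>?N1)"
    unfolding G_eq
  proof (rule integral_mono_AE)
    show "integrable ?N1 (\<lambda>u. \<integral>v. G u v \<partial>?N2)"
      using integrable_fst'[OF G_int] by simp
    show "integrable ?N1 (\<lambda>u. ?q - ?h U u + ?h (dual_op P U) u)"
      by (intro Bochner_Integration.integrable_add Bochner_Integration.integrable_diff
          N1.integrable_const h wp wp')
    show "AE u in ?N1. (\<integral>v. G u v \<partial>?N2) \<le> ?q - ?h U u + ?h (dual_op P U) u"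
      using inner by eventually_elim simp
  qed
  also have "\<dots> = (\<integral>u. ?q - ?h U u \<partial>?N1) + (\<integral>u. ?h (dual_op P U) u \<partial>?N1)"
    by (intro Bochner_Integration.integral_add Bochner_Integration.integrable_diff
        N1.integrable_const h wp wp')
  also have "(\<integral>u. ?q - ?h U u \<partial>?N1) = 0"
    using N1.prob_space h[OF wp] by (subst Bochner_Integration.integral_diff) auto
  finally show "dual_op P U t x \<le> q_value P (dual_op P U) t x a"
    using h(2)[OF wp'] by simp
qed

section \<open>Comparison with the cost-to-go functions\<close>

lemma cost_to_go_subsolution:
  assumes "value_wellposed P" "satisfies_bellman P (cost_to_go P)"
  shows "bellman_subsolution P (cost_to_go P)"
  unfolding bellman_subsolution_def
proof (intro conjI allI impI ballI)
  fix x show "cost_to_go P (horizon P) x \<le> terminal_cost P x"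
    by (simp add: cost_to_go_def)
next
  fix t x a assume t: "t < horizon P" and a: "a \<in> actions P t"
  have "cost_to_go P t x = (INF a\<in>actions P t. q_value P (cost_to_go P) t x a)"
    using assms(2) t by (simp add: satisfies_bellman_def q_value_def)
  also have "\<dots> \<le> q_value P (cost_to_go P) t x a"
    using assms(1) t a by (intro cINF_lower) (auto simp: value_wellposed_def q_value_def)
  finally show "cost_to_go P t x \<le> q_value P (cost_to_go P) t x a" .
qed

lemma subsolution_le_cost_to_go:
  assumes setting: "sdp_setting P" and vwp: "value_wellposed P"
    and bellman: "satisfies_bellman P (cost_to_go P)"
    and wp: "dual_wellposed P U" and sub: "bellman_subsolution P U"
    and "t \<le> horizon P"
  shows "U t x \<le> cost_to_go P t x"
  using \<open>t \<le> horizon P\<close>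
proof (induction t arbitrary: x rule: inc_induct)
  case base
  show ?case using sub by (simp add: bellman_subsolution_def cost_to_go_def)
next
  case (step t)
  have "U t x \<le> (INF a\<in>actions P t. q_value P (cost_to_go P) t x a)"
  proof (rule cINF_greatest)
    show "actions P t \<noteq> {}" using setting step by (simp add: sdp_setting_def)
    fix a assume a: "a \<in> actions P t"
    have "U t x \<le> q_value P U t x a"
      using sub a step by (simp add: bellman_subsolution_def)
    also have "\<dots> \<le> q_value P (cost_to_go P) t x a"
      unfolding q_value_def using wp vwp a step
      by (intro integral_mono) (auto simp: dual_wellposed_def value_wellposed_def)
    finally show "U t x \<le> q_value P (cost_to_go P) t x a" .
  qed
  also have "\<dots> = cost_to_go P t x"
    using bellman step by (simp add: satisfies_bellman_def q_value_def)
  finally show ?case .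
qed

text \<open>
  The bound from above holds for every \<open>U\<close>, since \<open>D U\<close> is a subsolution; the one from below is
  where exactness of \<open>U\<close> after time \<open>t\<close> enters.
\<close>

lemma dual_op_eq_cost_to_go:
  assumes setting: "sdp_setting P" and vwp: "value_wellposed P"
    and bellman: "satisfies_bellman P (cost_to_go P)"
    and wp: "dual_wellposed P U" and wp': "dual_wellposed P (dual_op P U)"
    and t: "t \<le> horizon P"
    and eq: "\<And>s x. s \<in> {Suc t..horizon P} \<Longrightarrow> U s x = cost_to_go P s x"
  shows "dual_op P U t x = cost_to_go P t x"
proof (rule antisym)
  show "dual_op P U t x \<le> cost_to_go P t x"
    using setting vwp bellman wp' dual_op_subsolution[OF setting wp wp'] t
    by (rule subsolution_le_cost_to_go)
  show "cost_to_go P t x \<le> dual_op P U t x"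
    using setting cost_to_go_subsolution[OF vwp bellman] t wp eq
    by (rule subsolution_le_dual_op)
qed

section \<open>Monotone convergence of the dual iterates\<close>

theorem theorem3p3:
  fixes P :: "('w, 'n::finite, 'm::finite, 'd::finite) sdp"
    and W :: "nat \<Rightarrow> real ^ 'n \<Rightarrow> real"
  assumes setting: "sdp_setting P"
    and value_wellposed: "value_wellposed P"
    and bellman: "satisfies_bellman P (cost_to_go P)"
    and dual_wellposed: "\<And>k. dual_wellposed P ((dual_op P ^^ k) W)"
  shows "(\<forall>k\<ge>1. \<forall>t\<le>horizon P. \<forall>x.
            (dual_op P ^^ (k + 1)) W t x \<ge> (dual_op P ^^ k) W t x) \<and>
         (\<forall>k\<ge>1.
            (\<forall>t\<le>horizon P. \<forall>x. (dual_op P ^^ (k + 1)) W t x = (dual_op P ^^ k) W t x) \<longrightarrow>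
            (\<forall>t\<le>horizon P. \<forall>x. (dual_op P ^^ k) W t x = cost_to_go P t x)) \<and>
         (\<forall>t\<le>horizon P. \<forall>x. (dual_op P ^^ (horizon P + 1)) W t x = cost_to_go P t x)"
proof (intro conjI allI impI)
  let ?D = "\<lambda>k. (dual_op P ^^ k) W"
  have wp: "dual_wellposed P (dual_op P (?D k))" for k
    using dual_wellposed[of "Suc k"] by simp
  have exact: "?D (Suc k) t x = cost_to_go P t x"
    if "t \<le> horizon P" "\<And>s x. s \<in> {Suc t..horizon P} \<Longrightarrow> ?D k s x = cost_to_go P s x" for k t x
    using dual_op_eq_cost_to_go[OF setting value_wellposed bellman dual_wellposed wp that] by simp
  {
    fix k :: nat and t x assume "1 \<le> k" "t \<le> horizon P"
    then obtain j where k: "k = Suc j" by (cases k) auto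
    have "bellman_subsolution P (?D k)"
      using dual_op_subsolution[OF setting dual_wellposed wp] by (simp add: k)
    then show "?D k t x \<le> ?D (k + 1) t x"
      using subsolution_le_dual_op[OF setting _ \<open>t \<le> horizon P\<close> dual_wellposed[of k]] by simp
  next
    fix k :: nat and t x assume fixed: "\<forall>t\<le>horizon P. \<forall>x. ?D (k + 1) t x = ?D k t x"
      and "t \<le> horizon P"
    have "\<forall>s\<in>{t..horizon P}. \<forall>x. ?D k s x = cost_to_go P s x"
      using \<open>t \<le> horizon P\<close>
    proof (induction t rule: inc_induct)
      case base
      then show ?case using exact[of "horizon P" k] fixed by auto
    next
      case (step t)
      have "?D k t x = cost_to_go P t x" for x
        using exact[of t k x] fixed step by auto
      moreover have "{t..horizon P} = insert t {Suc t..horizon P}"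
        using step by auto
      ultimately show ?case using step.IH by simp
    qed
    then show "?D k t x = cost_to_go P t x"
      using \<open>t \<le> horizon P\<close> by simp
  next
    fix t x assume "t \<le> horizon P"
    \<comment> \<open>After \<open>k + 1\<close> applications the last \<open>k + 1\<close> times \<open>T - k, \<dots>, T\<close> are exact.\<close>
    have "?D (Suc k) t x = cost_to_go P t x" if "horizon P \<le> t + k" "t \<le> horizon P" for k t x
      using that
    proof (induction k arbitrary: t x)
      case 0
      then show ?case by (intro exact) auto
    next
      case (Suc k)
      then show ?case by (intro exact[where k = "Suc k"] Suc.IH) auto
    qed
    then show "?D (horizon P + 1) t x = cost_to_go P t x"
      using \<open>t \<le> horizon P\<close> by simp
  }
qed

end
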